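(* Let $\widehat{\mathbf b}=(\hat x_1,\hat x_2,\ldots,\hat x_m)\in B$, where $\hat x_d\in\Omega_d$ with $\mathcal G_d(\hat x_d)$ nonzero everywhere (in every entry) for all $d=1,2,\ldots,m$. Then for any number $\varepsilon>0$ there is a neighborhood $U_\varepsilon(\widehat{\mathbf b})$ of $\widehat{\mathbf b}$ in $\mathcal H^m$ on which the alternating projection operator $T_{\mathrm{AP}}=P_AP_B$ is almost averaged with violation $\varepsilon$ and averaging constant $\alpha=2/3$.
   Context: Let $n,m\ge1$ be integers. Products, absolute values, squares, square roots, exponentials and equalities of $n\times n$ arrays are elementwise; $\mathrm j=\sqrt{-1}$; indices are $\xi=(\xi_1,\xi_2)$, $1\le\xi_1,\xi_2\le n$, and $w[\xi]$ is the entry of $w$ at $\xi$. Let $\mathcal I=\{XX,XY,XZ,YX,YY,YZ\}$ and $\mathcal H=(\mathbb C^{n\times n})^6$, with elements $x=(x_c)_{c\in\mathcal I}$, with Frobenius norm $\|x\|^2=\sum_{c\in\mathcal I}\sum_\xi|x_c[\xi]|^2$; $\mathcal H^m$ carries the norm $\|(w_1,\dots,w_m)\|^2=\sum_d\|w_d\|^2$. The matrices $E_c$: for every index $\xi$ (sampling point of the lens aperture) let $(k_X,k_Y,k_Z)=(k_X[\xi],k_Y[\xi],k_Z[\xi])\in\mathbb R^3$ be a unit vector (the unit wave vector) with $1+k_Z\neq0$. The real $n\times n$ matrices $E_c$ are given entrywise by $E_{XX}=1-\frac{k_X^2}{1+k_Z}$, $E_{XY}=E_{YX}=-\frac{k_Xk_Y}{1+k_Z}$,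 $E_{YY}=1-\frac{k_Y^2}{1+k_Z}$, $E_{XZ}=-k_X$, $E_{YZ}=-k_Y$; they satisfy $\sum_{c\in\mathcal I}E_c^2=2$ in every entry. $\mathcal F$ is the (unitary) two-dimensional discrete Fourier transform on $\mathbb C^{n\times n}$; $\phi_d\in\mathbb R^{n\times n}$ and $r_d\in\mathbb R_+^{n\times n}$ (entrywise nonnegative), $d=1,\dots,m$, are given. Sets and functions: $\Omega_0=\{(E_c\cdot x)_{c\in\mathcal I}: x\in\mathbb C^{n\times n}\}$; $\Omega_d=\{x\in\mathcal H:\sum_{c\in\mathcal I}|\mathcal F(x_c\cdot e^{\mathrm j\phi_d})|^2=r_d\}$ for $d=1,\dots,m$; $\mathcal G_d(x)=\sqrt{\sum_{c\in\mathcal I}|\mathcal F(x_c\cdot e^{\mathrm j\phi_d})|^2}\in\mathbb R_+^{n\times n}$; $A=\{(x,\dots,x)\in\mathcal H^m: x\in\Omega_0\}$; $B=\Omega_1\times\cdots\times\Omega_m$. For a set $\Omega$, $P_\Omega(x)=\{w\in\Omega:\|x-w\|=\inf_{v\in\Omega}\|x-v\|\}$ (set-valued), and $T_{\mathrm{AP}}(u)=\bigcup_{b\in P_B(u)}P_A(b)$. Almost averagedness: a set-valued self-map $T$ is pointwise almost averaged at $y$ on a set $U$ with violation $\varepsilon\ge0$ and averaging constant $\alpha\in(0,1)$ if for all $y^+\in T(y)$, $z\in U$, $z^+\in T(z)$: $\|z^+-y^+\|^2\le(1+\varepsilon)\|z-y\|^2-\frac{1-\alpha}{\alpha}\|(z^+-z)-(y^+-y)\|^2$.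 It is almost averaged on $U$ if this holds at every $y\in U$ with the same $\varepsilon$ and $\alpha$. *)

theory Defs
  imports "HOL-Analysis.Analysis"
begin

text \<open>
  The index set \<open>{1,\<dots>,n}\<close> is a finite linearly ordered type \<open>'n\<close>, so that \<open>n = CARD('n) \<ge> 1\<close>; the index
  \<open>d \<in> {1,\<dots>,m}\<close> ranges over a finite type \<open>'m\<close>. The entry \<open>w[\<xi>\<^sub>1,\<xi>\<^sub>2]\<close> is \<open>w $ \<xi>\<^sub>1 $ \<xi>\<^sub>2\<close>. The
  Euclidean norm of nested vectors is the Frobenius norm at every level.
\<close>

datatype chan = XX | XY | XZ | YX | YY | YZ

instance chan :: finite
proof
  have "(UNIV :: chan set) \<subseteq> {XX, XY, XZ, YX, YY, YZ}"
    using chan.exhaust by auto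
  then show "finite (UNIV :: chan set)"
    by (rule finite_subset) simp
qed

type_synonym 'n carray = "complex^'n^'n"
type_synonym 'n rarray = "real^'n^'n"
type_synonym 'n hspace = "complex^'n^'n^chan"

text \<open>\<open>k $ 1\<close>, \<open>k $ 2\<close>, \<open>k $ 3\<close> are \<open>k\<^sub>X\<close>, \<open>k\<^sub>Y\<close>, \<open>k\<^sub>Z\<close>.\<close>

primrec E_entry :: "real^3 \<Rightarrow> chan \<Rightarrow> real" where
  "E_entry k XX = 1 - (k $ 1)\<^sup>2 / (1 + k $ 3)"
| "E_entry k XY = - (k $ 1 * k $ 2) / (1 + k $ 3)"
| "E_entry k XZ = - (k $ 1)"
| "E_entry k YX = - (k $ 1 * k $ 2) / (1 + k $ 3)"
| "E_entry k YY = 1 - (k $ 2)\<^sup>2 / (1 + k $ 3)"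
| "E_entry k YZ = - (k $ 2)"

definition E_mat :: "real^3^'n^'n \<Rightarrow> chan \<Rightarrow> 'n::finite rarray" where
  "E_mat k c = (\<chi> i j. E_entry (k $ i $ j) c)"

text \<open>The zero-based position \<open>\<xi>\<^sub>i - 1\<close> of an index.\<close>

definition pos :: "'n::{finite,linorder} \<Rightarrow> nat" where
  "pos i = card {j. j < i}"

text \<open>
  For \<open>n \<times> n\<close> arrays the factor \<open>1/n\<close> makes the two-dimensional discrete Fourier transform unitary.
\<close>

definition dft2 :: "'n::{finite,linorder} carray \<Rightarrow> 'n carray" where
  "dft2 w = (\<chi> p q. (1 / of_nat CARD('n)) *
     (\<Sum>i\<in>UNIV. \<Sum>j\<in>UNIV. w $ i $ j *
        exp (- (2 * of_real pi * \<i> * of_nat (pos p * pos i + pos q * pos j) / of_nat CARD('n)))))"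

definition phase_mult :: "'n::finite rarray \<Rightarrow> 'n carray \<Rightarrow> 'n carray" where
  "phase_mult \<phi> w = (\<chi> i j. w $ i $ j * exp (\<i> * of_real (\<phi> $ i $ j)))"

definition intensity :: "'n::{finite,linorder} rarray \<Rightarrow> 'n hspace \<Rightarrow> 'n rarray" where
  "intensity \<phi> x = (\<chi> i j. \<Sum>c\<in>UNIV. (cmod (dft2 (phase_mult \<phi> (x $ c)) $ i $ j))\<^sup>2)"

definition amplitude :: "'n::{finite,linorder} rarray \<Rightarrow> 'n hspace \<Rightarrow> 'n rarray" where
  "amplitude \<phi> x = (\<chi> i j. sqrt (intensity \<phi> x $ i $ j))"

definition Omega0 :: "real^3^'n^'n \<Rightarrow> ('n::finite hspace) set" where
  "Omega0 k = {(\<chi> c i j. of_real (E_mat k c $ i $ j) * x $ i $ j) | x :: 'n carray. True}"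

definition Omega :: "'n::{finite,linorder} rarray \<Rightarrow> 'n rarray \<Rightarrow> ('n hspace) set" where
  "Omega \<phi> r = {x. intensity \<phi> x = r}"

definition A_set :: "real^3^'n^'n \<Rightarrow> (('n::finite hspace)^'m::finite) set" where
  "A_set k = {(\<chi> d. x) | x. x \<in> Omega0 k}"

definition B_set ::
  "('n::{finite,linorder} rarray)^'m \<Rightarrow> ('n rarray)^'m \<Rightarrow> (('n hspace)^'m::finite) set" where
  "B_set \<phi> r = {w. \<forall>d. w $ d \<in> Omega (\<phi> $ d) (r $ d)}"

definition proj :: "'a::real_normed_vector set \<Rightarrow> 'a \<Rightarrow> 'a set" where
  "proj \<Omega> x = {w \<in> \<Omega>. norm (x - w) = (INF v\<in>\<Omega>. norm (x - v))}"

definition alt_proj :: "'a::real_normed_vector set \<Rightarrow> 'a set \<Rightarrow> 'a \<Rightarrow> 'a set" where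
  "alt_proj A B u = (\<Union>b\<in>proj B u. proj A b)"

definition almost_averaged_at ::
  "('a::real_normed_vector \<Rightarrow> 'a set) \<Rightarrow> 'a \<Rightarrow> 'a set \<Rightarrow> real \<Rightarrow> real \<Rightarrow> bool" where
  "almost_averaged_at T y U \<epsilon> \<alpha> \<longleftrightarrow>
     0 \<le> \<epsilon> \<and> 0 < \<alpha> \<and> \<alpha> < 1 \<and>
     (\<forall>y' \<in> T y. \<forall>z \<in> U. \<forall>z' \<in> T z.
        (norm (z' - y'))\<^sup>2 \<le> (1 + \<epsilon>) * (norm (z - y))\<^sup>2
           - (1 - \<alpha>) / \<alpha> * (norm ((z' - z) - (y' - y)))\<^sup>2)"

definition almost_averaged_on ::
  "('a::real_normed_vector \<Rightarrow> 'a set) \<Rightarrow> 'a set \<Rightarrow> real \<Rightarrow> real \<Rightarrow> bool" where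
  "almost_averaged_on T U \<epsilon> \<alpha> \<longleftrightarrow> (\<forall>y \<in> U. almost_averaged_at T y U \<epsilon> \<alpha>)"

end

theory Submission
  imports Defs
begin

text \<open>
  The operator is a composition \<open>P\<^sub>A \<circ> P\<^sub>B\<close>. The set \<open>A\<close> is a linear subspace, so \<open>P\<^sub>A\<close> is firmly
  nonexpansive, that is, averaged with constant \<open>1/2\<close> and violation \<open>0\<close>. The composition of a firmly
  nonexpansive map with a map that is almost averaged with constant \<open>1/2\<close> and violation \<open>\<epsilon>\<close> is almost
  averaged with constant \<open>2/3\<close> and the same violation, because the two residuals \<open>p, q\<close> satisfy
  \<open>\<parallel>p + q\<parallel>\<^sup>2 \<le> 2 (\<parallel>p\<parallel>\<^sup>2 + \<parallel>q\<parallel>\<^sup>2)\<close>. So everything reduces to \<open>P\<^sub>B\<close>.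

  Multiplication by phases followed by the Fourier transform is unitary (Parseval). In the
  transformed coordinates \<open>B\<close> is a product of spheres, one in \<open>\<complex>\<^sup>6\<close> for each pair of an image \<open>d\<close> and
  a pixel \<open>(p, q)\<close>, and the radii are positive because the amplitudes of the base point do not
  vanish. Hence \<open>P\<^sub>B\<close> is a product of radial projections \<open>y \<mapsto> \<rho> y / \<parallel>y\<parallel>\<close>. For unit vectors \<open>u, v\<close>
  with \<open>t = u \<bullet> v\<close> and \<open>y = a u\<close>, \<open>z = b v\<close>, the images \<open>y', z'\<close> satisfy
  \<open>2 \<parallel>z' - y'\<parallel>\<^sup>2 - 2 (z' - y') \<bullet> (z - y) = 2 \<rho> (1 - t) (2 \<rho> - a - b)\<close>, twice the defect of firm
  nonexpansiveness, whereas \<open>\<parallel>z - y\<parallel>\<^sup>2 \<ge> 2 a b (1 - t)\<close>. The quotient of the two is small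
  as soon as \<open>a\<close> and \<open>b\<close> are not much smaller than \<open>\<rho>\<close>. This describes the neighborhood: every
  transformed block must have norm larger than \<open>(1 - \<delta>)\<close> times the radius of its sphere.
\<close>

section \<open>Almost averaged maps and projections\<close>

lemma proj_norm_le:
  assumes "w \<in> proj S x" "v \<in> S"
  shows "norm (x - w) \<le> norm (x - v)"
proof -
  have "bdd_below ((\<lambda>v. norm (x - v)) ` S)"
    by (rule bdd_belowI[of _ 0]) auto
  then show ?thesis
    using assms by (auto simp: proj_def intro: cINF_lower)
qed

text \<open>
  Expanding the residual term turns the constant \<open>1/2\<close> into a bound on the defect
  \<open>\<parallel>z' - y'\<parallel>\<^sup>2 - (z' - y') \<bullet> (z - y)\<close> of firm nonexpansiveness. Every term of this form is additive
  over orthogonal blocks, so products can be treated block by block.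
\<close>

lemma almost_averaged_half_iff:
  fixes T :: "'a::real_inner \<Rightarrow> 'a set"
  shows "almost_averaged_on T U \<epsilon> (1/2) \<longleftrightarrow>
    U = {} \<or> 0 \<le> \<epsilon> \<and> (\<forall>y\<in>U. \<forall>z\<in>U. \<forall>y'\<in>T y. \<forall>z'\<in>T z.
        2 * (norm (z' - y'))\<^sup>2 - 2 * ((z' - y') \<bullet> (z - y)) \<le> \<epsilon> * (norm (z - y))\<^sup>2)"
proof -
  have expand: "(norm ((z' - z) - (y' - y)))\<^sup>2
      = (norm (z' - y'))\<^sup>2 - 2 * ((z' - y') \<bullet> (z - y)) + (norm (z - y))\<^sup>2" for z z' y y' :: 'a
    by (simp add: power2_norm_eq_inner inner_diff inner_commute algebra_simps)
  have "(norm (z' - y'))\<^sup>2 \<le> (1 + \<epsilon>) * (norm (z - y))\<^sup>2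
           - (1 - 1/2) / (1/2) * (norm ((z' - z) - (y' - y)))\<^sup>2 \<longleftrightarrow>
        2 * (norm (z' - y'))\<^sup>2 - 2 * ((z' - y') \<bullet> (z - y)) \<le> \<epsilon> * (norm (z - y))\<^sup>2"
    for z z' y y' :: 'a
    unfolding expand by (auto simp: distrib_right)
  then show ?thesis
    unfolding almost_averaged_on_def almost_averaged_at_def by auto
qed

text \<open>
  The variational inequality of a projection onto a convex set, used at both points, gives
  \<open>\<parallel>z' - y'\<parallel>\<^sup>2 \<le> (z' - y') \<bullet> (z - y)\<close>.
\<close>

lemma proj_convex_firmly_nonexpansive:
  fixes A :: "'a::euclidean_space set"
  assumes "convex A" "closed A"
  shows "almost_averaged_on (proj A) UNIV 0 (1/2)"
proof -
  have dot: "(x - w) \<bullet> (v - w) \<le> 0" if "w \<in> proj A x" "v \<in> A" for x w v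
  proof (rule any_closest_point_dot[OF assms _ that(2)])
    show "w \<in> A" using that(1) by (simp add: proj_def)
    show "\<forall>u\<in>A. dist x w \<le> dist x u"
      using proj_norm_le[OF that(1)] by (simp add: dist_norm)
  qed
  have "2 * (norm (z' - y'))\<^sup>2 - 2 * ((z' - y') \<bullet> (z - y)) \<le> 0"
    if "y' \<in> proj A y" "z' \<in> proj A z" for y y' z z'
  proof -
    have "(y - y') \<bullet> (z' - y') \<le> 0" "(z - z') \<bullet> (y' - z') \<le> 0"
      using dot that by (auto simp: proj_def)
    then show ?thesis
      by (simp add: power2_norm_eq_inner inner_diff inner_commute algebra_simps)
  qed
  then show ?thesis
    by (auto simp: almost_averaged_half_iff)
qed

lemma norm_add_sq_le:
  fixes p q :: "'a::real_inner"
  shows "(norm (p + q))\<^sup>2 \<le> 2 * (norm p)\<^sup>2 + 2 * (norm q)\<^sup>2"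
proof -
  have "0 \<le> (norm (p - q))\<^sup>2" by simp
  then show ?thesis
    by (simp add: power2_norm_eq_inner inner_diff inner_add inner_commute algebra_simps)
qed

lemma almost_averaged_comp:
  fixes P Q :: "'a::real_inner \<Rightarrow> 'a set"
  assumes P: "almost_averaged_on P UNIV 0 (1/2)"
    and Q: "almost_averaged_on Q U \<epsilon> (1/2)"
  shows "almost_averaged_on (\<lambda>u. \<Union>b\<in>Q u. P b) U \<epsilon> (2/3)"
proof -
  have "(norm (z' - y'))\<^sup>2 \<le> (1 + \<epsilon>) * (norm (z - y))\<^sup>2
           - (1 - 2/3) / (2/3) * (norm ((z' - z) - (y' - y)))\<^sup>2"
    if "y \<in> U" "z \<in> U" and b: "b \<in> Q y" "y' \<in> P b" and c: "c \<in> Q z" "z' \<in> P c"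
    for y y' b z z' c
  proof -
    let ?p = "(z' - c) - (y' - b)" and ?q = "(c - z) - (b - y)"
    have "(norm (z' - y'))\<^sup>2 \<le> (norm (c - b))\<^sup>2 - (norm ?p)\<^sup>2"
      using P b c by (auto simp: almost_averaged_on_def almost_averaged_at_def)
    moreover have "(norm (c - b))\<^sup>2 \<le> (1 + \<epsilon>) * (norm (z - y))\<^sup>2 - (norm ?q)\<^sup>2"
      using Q that by (auto simp: almost_averaged_on_def almost_averaged_at_def)
    moreover have "(norm (?p + ?q))\<^sup>2 \<le> 2 * (norm ?p)\<^sup>2 + 2 * (norm ?q)\<^sup>2"
      by (rule norm_add_sq_le)
    moreover have "?p + ?q = (z' - z) - (y' - y)" by simp
    ultimately show ?thesis by simp
  qed
  then show ?thesis
    using Q unfolding almost_averaged_on_def almost_averaged_at_def by auto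
qed

section \<open>Projection onto products of spheres\<close>

text \<open>
  The nearest point \<open>w\<close> is compared with \<open>\<rho> y / \<parallel>y\<parallel>\<close>: being at least as close to \<open>y\<close>, it attains
  equality in the Cauchy-Schwarz inequality.
\<close>

lemma nearest_on_sphere_eq:
  fixes y w :: "'a::real_inner"
  assumes "y \<noteq> 0" and w: "norm w = \<rho>"
    and min: "\<And>v. norm v = \<rho> \<Longrightarrow> norm (y - w) \<le> norm (y - v)"
  shows "w = (\<rho> / norm y) *\<^sub>R y"
proof -
  define v where "v = (\<rho> / norm y) *\<^sub>R y"
  have "\<rho> \<ge> 0" using w by auto
  then have nv: "norm v = \<rho>" and yv: "y \<bullet> v = \<rho> * norm y"
    using \<open>y \<noteq> 0\<close> by (simp_all add: v_def dot_square_norm power2_eq_square)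
  have "(norm (y - w))\<^sup>2 \<le> (norm (y - v))\<^sup>2"
    using min[OF nv] by (simp add: power_mono)
  moreover have "(norm (y - x))\<^sup>2 = (norm y)\<^sup>2 - 2 * (y \<bullet> x) + (norm x)\<^sup>2" for x
    by (simp add: power2_norm_eq_inner inner_diff inner_commute algebra_simps)
  ultimately have "norm y * norm w \<le> y \<bullet> w"
    using yv nv w by (simp add: mult.commute)
  then have "y \<bullet> w = norm y * norm w"
    using norm_cauchy_schwarz[of y w] by linarith
  then have "norm y *\<^sub>R w = norm w *\<^sub>R y"
    by (simp only: norm_cauchy_schwarz_eq)
  then have "norm y *\<^sub>R w = \<rho> *\<^sub>R y"
    by (simp only: w)
  then have "(1 / norm y) *\<^sub>R (norm y *\<^sub>R w) = (1 / norm y) *\<^sub>R (\<rho> *\<^sub>R y)"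
    by simp
  then show ?thesis using \<open>y \<noteq> 0\<close> by simp
qed

text \<open>
  With \<open>a = \<parallel>y\<parallel>\<close>, \<open>b = \<parallel>z\<parallel>\<close> and \<open>t\<close> the cosine of the angle between \<open>y\<close> and \<open>z\<close>, the left-hand side
  is \<open>2 \<rho> (1 - t) (2 \<rho> - a - b)\<close> and the right-hand side is at least \<open>2 \<epsilon> a b (1 - t)\<close>. The
  lower bounds give \<open>2 \<rho> - a - b \<le> 2 \<delta> \<rho>\<close> and \<open>a b \<ge> (1 - \<delta>)\<^sup>2 \<rho>\<^sup>2\<close>, which is where the condition
  on \<open>\<delta>\<close> comes from.
\<close>

lemma sphere_projection_almost_firm:
  fixes y z :: "'a::real_inner"
  assumes "0 < \<rho>" "\<delta> < 1" and \<delta>: "2 * \<delta> \<le> \<epsilon> * (1 - \<delta>)\<^sup>2" and "0 \<le> \<epsilon>"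
    and y: "(1 - \<delta>) * \<rho> < norm y" and z: "(1 - \<delta>) * \<rho> < norm z"
  defines "y' \<equiv> (\<rho> / norm y) *\<^sub>R y" and "z' \<equiv> (\<rho> / norm z) *\<^sub>R z"
  shows "2 * (norm (z' - y'))\<^sup>2 - 2 * ((z' - y') \<bullet> (z - y)) \<le> \<epsilon> * (norm (z - y))\<^sup>2"
proof -
  define a b where "a = norm y" and "b = norm z"
  define t where "t = (y \<bullet> z) / (a * b)"
  have pos: "0 < (1 - \<delta>) * \<rho>" using assms by simp
  then have ab: "0 < a" "0 < b" using y z by (auto simp: a_def b_def)
  have yz: "y \<bullet> z = a * b * t" using ab by (simp add: t_def)
  have "t \<le> 1"
    using norm_cauchy_schwarz[of y z] ab by (simp add: t_def a_def b_def)
  have yy: "y \<bullet> y = a\<^sup>2" and zz: "z \<bullet> z = b\<^sup>2"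
    by (simp_all add: a_def b_def power2_norm_eq_inner)
  have "(norm (z' - y'))\<^sup>2 = 2 * (1 - t) * \<rho>\<^sup>2"
    using ab unfolding y'_def z'_def a_def[symmetric] b_def[symmetric] power2_norm_eq_inner
    by (simp add: inner_diff inner_commute[of z y] yz yy zz field_simps power2_eq_square)
  moreover have "(z' - y') \<bullet> (z - y) = \<rho> * (a + b) * (1 - t)"
    using ab unfolding y'_def z'_def a_def[symmetric] b_def[symmetric]
    by (simp add: inner_diff inner_commute[of z y] yz yy zz field_simps power2_eq_square)
  ultimately have lhs: "2 * (norm (z' - y'))\<^sup>2 - 2 * ((z' - y') \<bullet> (z - y))
      = (2 * (1 - t)) * (\<rho> * (2 * \<rho> - a - b))"
    by (simp add: algebra_simps power2_eq_square)
  have dist: "(norm (z - y))\<^sup>2 = (a - b)\<^sup>2 + (2 * (1 - t)) * (a * b)"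
    unfolding power2_norm_eq_inner
    by (simp add: inner_diff inner_commute[of z y] yz yy zz algebra_simps power2_eq_square)
  have "2 * \<rho> - a - b \<le> 2 * \<delta> * \<rho>"
    using y z by (simp add: a_def b_def algebra_simps)
  then have "\<rho> * (2 * \<rho> - a - b) \<le> \<rho> * (2 * \<delta> * \<rho>)"
    using \<open>0 < \<rho>\<close> by simp
  also have "\<dots> = 2 * \<delta> * \<rho>\<^sup>2" by (simp add: power2_eq_square)
  also have "\<dots> \<le> \<epsilon> * (1 - \<delta>)\<^sup>2 * \<rho>\<^sup>2" using \<delta> by (simp add: mult_right_mono)
  also have "\<dots> = \<epsilon> * (((1 - \<delta>) * \<rho>) * ((1 - \<delta>) * \<rho>))" by (simp add: power2_eq_square)
  also have "\<dots> \<le> \<epsilon> * (a * b)"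
    using y z pos \<open>0 \<le> \<epsilon>\<close> by (intro mult_left_mono mult_mono) (auto simp: a_def b_def)
  finally have "(2 * (1 - t)) * (\<rho> * (2 * \<rho> - a - b)) \<le> (2 * (1 - t)) * (\<epsilon> * (a * b))"
    using \<open>t \<le> 1\<close> by (intro mult_left_mono) auto
  also have "\<dots> \<le> \<epsilon> * (norm (z - y))\<^sup>2"
    using \<open>0 \<le> \<epsilon>\<close> by (simp add: dist algebra_simps)
  finally show ?thesis using lhs by simp
qed

lemma norm_sq_vec: "(norm x)\<^sup>2 = (\<Sum>i\<in>UNIV. (norm (x $ i))\<^sup>2)"
  for x :: "'a::real_normed_vector^'i::finite"
  by (simp add: norm_vec_def L2_set_def sum_nonneg)

text \<open>
  Replacing one block of \<open>F b\<close> and leaving the others gives a competitor for \<open>b\<close>; this is where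
  surjectivity of \<open>F\<close> enters. Hence the projection acts blockwise.
\<close>

lemma proj_sphere_product_block:
  fixes F :: "'a::real_inner \<Rightarrow> 'v::real_inner^'i::finite"
  assumes lin: "linear F" and iso: "\<And>x. norm (F x) = norm x" and "surj F"
    and b: "b \<in> proj {w. \<forall>s. norm (F w $ s) = \<rho> s} y" and "F y $ s \<noteq> 0"
  shows "F b $ s = (\<rho> s / norm (F y $ s)) *\<^sub>R (F y $ s)"
proof (rule nearest_on_sphere_eq[OF \<open>F y $ s \<noteq> 0\<close>])
  let ?B = "{w. \<forall>s. norm (F w $ s) = \<rho> s}"
  have bB: "norm (F b $ t) = \<rho> t" for t using b by (simp add: proj_def)
  then show "norm (F b $ s) = \<rho> s" .
  fix v :: 'v assume v: "norm v = \<rho> s"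
  obtain w where w: "F w = (\<chi> t. if t = s then v else F b $ t)"
    using \<open>surj F\<close> by (metis surjD)
  then have "w \<in> ?B" using v bB by simp
  then have "(norm (F (y - b)))\<^sup>2 \<le> (norm (F (y - w)))\<^sup>2"
    using proj_norm_le[OF b] by (simp add: iso power_mono)
  then have "(\<Sum>t\<in>UNIV. (norm (F y $ t - F b $ t))\<^sup>2) \<le> (\<Sum>t\<in>UNIV. (norm (F y $ t - F w $ t))\<^sup>2)"
    by (simp only: norm_sq_vec[of "F _ - F _"] linear_diff[OF lin] vector_minus_component)
  moreover have "(\<Sum>t\<in>UNIV - {s}. (norm (F y $ t - F w $ t))\<^sup>2)
      = (\<Sum>t\<in>UNIV - {s}. (norm (F y $ t - F b $ t))\<^sup>2)"
    by (intro sum.cong) (auto simp: w)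
  ultimately have "(norm (F y $ s - F b $ s))\<^sup>2 \<le> (norm (F y $ s - v))\<^sup>2"
    by (simp add: sum.remove[of UNIV s] w)
  then show "norm (F y $ s - F b $ s) \<le> norm (F y $ s - v)"
    by (rule power2_le_imp_le) simp
qed

lemma inner_isometry:
  fixes F :: "'a::real_inner \<Rightarrow> 'b::real_inner"
  assumes "linear F" "\<And>x. norm (F x) = norm x"
  shows "F x \<bullet> F y = x \<bullet> y"
  using assms(2)[of "x + y"] assms(2)[of x] assms(2)[of y]
  by (simp add: linear_add[OF assms(1)] dot_norm)

text \<open>
  The neighborhood only bounds the blocks from below: in the estimate for a single sphere, the
  defect decreases and the comparison term \<open>2 a b (1 - t)\<close> increases as the points move outwards
  along their rays.
\<close>

lemma proj_sphere_product_almost_averaged: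
  fixes F :: "'a::real_inner \<Rightarrow> 'v::real_inner^'i::finite"
  assumes lin: "linear F" and iso: "\<And>x. norm (F x) = norm x" and "surj F"
    and \<rho>: "\<And>s. 0 < \<rho> s"
    and \<delta>: "\<delta> < 1" "2 * \<delta> \<le> \<epsilon> * (1 - \<delta>)\<^sup>2" and "0 \<le> \<epsilon>"
  shows "almost_averaged_on (proj {w. \<forall>s. norm (F w $ s) = \<rho> s})
     {w. \<forall>s. (1 - \<delta>) * \<rho> s < norm (F w $ s)} \<epsilon> (1/2)"
proof -
  have "2 * (norm (z' - y'))\<^sup>2 - 2 * ((z' - y') \<bullet> (z - y)) \<le> \<epsilon> * (norm (z - y))\<^sup>2"
    if y: "\<forall>s. (1 - \<delta>) * \<rho> s < norm (F y $ s)" and z: "\<forall>s. (1 - \<delta>) * \<rho> s < norm (F z $ s)"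
      and y': "y' \<in> proj {w. \<forall>s. norm (F w $ s) = \<rho> s} y"
      and z': "z' \<in> proj {w. \<forall>s. norm (F w $ s) = \<rho> s} z" for y y' z z'
  proof -
    have "0 < (1 - \<delta>) * \<rho> s" for s using \<rho>[of s] \<delta>(1) by simp
    then have "F y $ s \<noteq> 0" "F z $ s \<noteq> 0" for s
      using y z by (metis less_asym norm_zero)+
    note blocks = proj_sphere_product_block[OF lin iso \<open>surj F\<close> y' this(1)]
      proj_sphere_product_block[OF lin iso \<open>surj F\<close> z' this(2)]
    have "2 * (norm (F z' $ s - F y' $ s))\<^sup>2 - 2 * ((F z' $ s - F y' $ s) \<bullet> (F z $ s - F y $ s))
        \<le> \<epsilon> * (norm (F z $ s - F y $ s))\<^sup>2" for s
      unfolding blocks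
      using sphere_projection_almost_firm[OF \<rho> \<delta> \<open>0 \<le> \<epsilon>\<close>, of s "F y $ s" "F z $ s"] y z by blast
    then have "(\<Sum>s\<in>UNIV. 2 * (norm (F z' $ s - F y' $ s))\<^sup>2
          - 2 * ((F z' $ s - F y' $ s) \<bullet> (F z $ s - F y $ s)))
        \<le> (\<Sum>s\<in>UNIV. \<epsilon> * (norm (F z $ s - F y $ s))\<^sup>2)"
      by (rule sum_mono)
    then have "2 * (norm (F (z' - y')))\<^sup>2 - 2 * (F (z' - y') \<bullet> F (z - y))
        \<le> \<epsilon> * (norm (F (z - y)))\<^sup>2"
      by (simp add: norm_sq_vec[of "F _ - F _"] inner_vec_def linear_diff[OF lin] sum_subtractf
          flip: sum_distrib_left)
    then show ?thesis
      by (simp add: iso inner_isometry[OF lin iso])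
  qed
  then show ?thesis
    using \<open>0 \<le> \<epsilon>\<close> by (simp add: almost_averaged_half_iff)
qed

section \<open>Unitarity of the Fourier transform\<close>

lemma bij_betw_pos: "bij_betw (pos :: 'n::{finite,linorder} \<Rightarrow> nat) UNIV {..<CARD('n)}"
proof -
  have "strict_mono (pos :: 'n \<Rightarrow> nat)"
    unfolding pos_def by (intro strict_monoI psubset_card_mono) auto
  then have inj: "inj (pos :: 'n \<Rightarrow> nat)" by (rule strict_mono_imp_inj_on)
  have "pos i < CARD('n)" for i :: 'n
    unfolding pos_def by (intro psubset_card_mono) auto
  then have "range (pos :: 'n \<Rightarrow> nat) \<subseteq> {..<CARD('n)}" by auto
  then have "range (pos :: 'n \<Rightarrow> nat) = {..<CARD('n)}"
    by (rule card_subset_eq[rotated]) (simp_all add: card_image[OF inj])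
  with inj show ?thesis by (simp add: bij_betw_def)
qed

definition dft_kernel :: "'n::{finite,linorder} \<Rightarrow> 'n \<Rightarrow> complex" where
  "dft_kernel p i = exp (- (2 * of_real pi * \<i> * of_nat (pos p * pos i) / of_nat CARD('n)))"

text \<open>
  The product of the two kernel values is the \<open>pos p\<close>-th power of a quotient of two \<open>n\<close>-th roots of
  unity, so for \<open>i \<noteq> j\<close> the sum is a full geometric sum of a root of unity different from \<open>1\<close>.
\<close>

lemma dft_kernel_orthogonal:
  "(\<Sum>p\<in>UNIV. dft_kernel p i * cnj (dft_kernel p j)) = (if i = j then of_nat CARD('n) else 0)"
  for i j :: "'n::{finite,linorder}"
proof -
  let ?n = "CARD('n)"
  define root where "root l = exp (2 * of_real pi * \<i> * of_nat l / of_nat ?n)" for l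
  define \<zeta> where "\<zeta> = root (pos j) / root (pos i)"
  have root_pow: "root l ^ k = root (k * l)" for l k
    by (simp add: root_def flip: exp_of_nat_mult)
       (simp add: field_simps)
  have kern: "dft_kernel p i = inverse (root (pos i) ^ pos p)" for p i :: 'n
    unfolding root_pow by (simp add: dft_kernel_def root_def exp_minus)
  have cnj_root: "cnj (root l) = inverse (root l)" for l
    by (simp add: root_def exp_cnj flip: exp_minus)
  have "dft_kernel p i * cnj (dft_kernel p j) = \<zeta> ^ pos p" for p :: 'n
    by (simp add: kern cnj_root \<zeta>_def field_simps power_divide)
  then have "(\<Sum>p\<in>UNIV. dft_kernel p i * cnj (dft_kernel p j)) = (\<Sum>p\<in>(UNIV::'n set). \<zeta> ^ pos p)"
    by simp
  also have "\<dots> = (\<Sum>k<?n. \<zeta> ^ k)"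
    by (rule sum.reindex_bij_betw[OF bij_betw_pos])
  also have "\<dots> = (if i = j then of_nat ?n else 0)"
  proof (cases "i = j")
    case True
    then have "\<zeta> = 1" by (simp add: \<zeta>_def root_def)
    with True show ?thesis by simp
  next
    case False
    have lt: "pos i < ?n" "pos j < ?n" and "pos i \<noteq> pos j"
      using bij_betw_pos[where 'n='n] False
      by (auto simp: bij_betw_def inj_on_def)
    then have "root (pos i) \<noteq> root (pos j)"
      unfolding root_def by (subst complex_root_unity_eq) (auto simp: cong_def)
    then have "\<zeta> \<noteq> 1" by (simp add: \<zeta>_def root_def)
    moreover have "root l ^ ?n = 1" for l
      unfolding root_pow by (simp add: root_def exp_eq_1) (metis of_int_of_nat_eq)
    then have "\<zeta> ^ ?n = 1" by (simp add: \<zeta>_def power_divide)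
    ultimately show ?thesis using False by (simp add: geometric_sum)
  qed
  finally show ?thesis .
qed

lemma dft_kernel_parseval:
  "(\<Sum>p\<in>UNIV. (cmod (\<Sum>i\<in>UNIV. v i * dft_kernel p i))\<^sup>2) = real CARD('n) * (\<Sum>i\<in>UNIV. (cmod (v i))\<^sup>2)"
  for v :: "'n::{finite,linorder} \<Rightarrow> complex"
proof -
  have "complex_of_real (\<Sum>p\<in>UNIV. (cmod (\<Sum>i\<in>UNIV. v i * dft_kernel p i))\<^sup>2)
      = (\<Sum>p\<in>UNIV. \<Sum>i\<in>UNIV. \<Sum>j\<in>UNIV. v i * cnj (v j) * (dft_kernel p i * cnj (dft_kernel p j)))"
    by (simp only: of_real_sum complex_norm_square cnj_sum sum_product complex_cnj_mult mult_ac)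
  also have "\<dots> = (\<Sum>i\<in>UNIV. \<Sum>j\<in>UNIV. \<Sum>p\<in>UNIV. v i * cnj (v j) * (dft_kernel p i * cnj (dft_kernel p j)))"
    by (rule trans[OF sum.swap], rule sum.cong[OF refl], rule sum.swap)
  also have "\<dots> = (\<Sum>i\<in>UNIV. v i * cnj (v i) * of_nat CARD('n))"
    by (simp add: dft_kernel_orthogonal if_distrib cong: if_cong flip: sum_distrib_left)
  also have "\<dots> = complex_of_real (real CARD('n) * (\<Sum>i\<in>UNIV. (cmod (v i))\<^sup>2))"
    by (simp only: of_real_mult of_real_sum complex_norm_square of_real_of_nat_eq
        sum_distrib_left mult_ac)
  finally show ?thesis by (simp only: of_real_eq_iff)
qed

lemma norm_sq_array: "(norm w)\<^sup>2 = (\<Sum>i\<in>UNIV. \<Sum>j\<in>UNIV. (cmod (w $ i $ j))\<^sup>2)"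
  for w :: "complex^'n::finite^'m::finite"
  by (simp add: norm_sq_vec)

lemma dft2_entry:
  "dft2 w $ p $ q = (\<Sum>i\<in>UNIV. (\<Sum>j\<in>UNIV. w $ i $ j * dft_kernel q j) * dft_kernel p i) / of_nat CARD('n)"
  for w :: "'n::{finite,linorder} carray"
proof -
  have "exp (- (2 * of_real pi * \<i> * of_nat (pos p * pos i + pos q * pos j) / of_nat CARD('n)))
     = dft_kernel p i * dft_kernel q j" for i j :: 'n
    by (simp add: dft_kernel_def add_divide_distrib distrib_left flip: exp_add)
  then show ?thesis
    by (simp add: dft2_def sum_distrib_right) (simp add: mult_ac)
qed

text \<open>The transform is separable: one-dimensional Parseval is applied in the first index, then in the second.\<close>

lemma norm_dft2: "norm (dft2 w) = norm w" for w :: "'n::{finite,linorder} carray"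
proof -
  let ?n = "real CARD('n)"
  define g where "g q i = (\<Sum>j\<in>UNIV. w $ i $ j * dft_kernel q j)" for q i
  have "(norm (dft2 w))\<^sup>2 = (\<Sum>p\<in>UNIV. \<Sum>q\<in>UNIV. (cmod (\<Sum>i\<in>UNIV. g q i * dft_kernel p i))\<^sup>2) / ?n\<^sup>2"
    by (simp add: norm_sq_array dft2_entry g_def norm_divide power_divide)
       (simp add: sum_divide_distrib)
  also have "(\<Sum>p\<in>UNIV. \<Sum>q\<in>UNIV. (cmod (\<Sum>i\<in>UNIV. g q i * dft_kernel p i))\<^sup>2)
      = (\<Sum>q\<in>UNIV. ?n * (\<Sum>i\<in>UNIV. (cmod (g q i))\<^sup>2))"
    by (subst sum.swap) (simp add: dft_kernel_parseval)
  also have "\<dots> = ?n * (\<Sum>i\<in>UNIV. \<Sum>q\<in>UNIV. (cmod (g q i))\<^sup>2)"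
    by (subst sum.swap) (simp add: sum_distrib_left)
  also have "\<dots> = ?n * (?n * (norm w)\<^sup>2)"
    by (simp add: g_def dft_kernel_parseval norm_sq_array sum_distrib_left)
  finally have "(norm (dft2 w))\<^sup>2 = (norm w)\<^sup>2"
    by (simp add: power2_eq_square)
  then show ?thesis by simp
qed

lemma linear_dft2: "linear (dft2 :: 'n::{finite,linorder} carray \<Rightarrow> 'n carray)"
proof (rule linearI)
  show "dft2 (v + w) = dft2 v + dft2 w" for v w :: "'n carray"
    by (simp add: vec_eq_iff dft2_entry distrib_right sum.distrib add_divide_distrib)
  show "dft2 (a *\<^sub>R w) = a *\<^sub>R dft2 w" for a and w :: "'n carray"
    by (simp add: vec_eq_iff dft2_entry scaleR_conv_of_real[where 'a=complex] mult.assoc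
        flip: sum_distrib_left)
qed

lemma norm_phase_mult: "norm (phase_mult \<phi> w) = norm w"
proof -
  have "(norm (phase_mult \<phi> w))\<^sup>2 = (norm w)\<^sup>2"
    by (simp add: norm_sq_array phase_mult_def norm_mult)
  then show ?thesis by simp
qed

lemma linear_phase_mult: "linear (phase_mult \<phi>)"
  by (rule linearI) (simp_all add: vec_eq_iff phase_mult_def distrib_right)

lemma surj_dft2_phase_mult: "surj (\<lambda>w. dft2 (phase_mult \<phi> w))"
  for \<phi> :: "'n::{finite,linorder} rarray"
proof -
  have lin: "linear (\<lambda>w. dft2 (phase_mult \<phi> w))"
    using linear_compose[OF linear_phase_mult linear_dft2] by (simp add: o_def)
  have "dft2 (phase_mult \<phi> w) = 0 \<longrightarrow> w = 0" for w
    by (metis norm_dft2 norm_phase_mult norm_eq_zero)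
  then show ?thesis
    using lin by (intro linear_injective_imp_surjective) (simp_all add: linear_inj_iff_eq_0)
qed

section \<open>The measurement set in Fourier coordinates\<close>

text \<open>
  The channels form the innermost index here, so that the \<open>(d, p, q)\<close> block is the vector in \<open>\<complex>\<^sup>6\<close>
  whose norm is the amplitude of image \<open>d\<close> at pixel \<open>(p, q)\<close>.
\<close>

definition fourier_blocks ::
  "('n::{finite,linorder} rarray)^'m \<Rightarrow> ('n hspace)^'m \<Rightarrow> (complex^chan)^('m::finite \<times> 'n \<times> 'n)" where
  "fourier_blocks \<phi> w = (\<chi> s. \<chi> c.
     dft2 (phase_mult (\<phi> $ fst s) (w $ fst s $ c)) $ fst (snd s) $ snd (snd s))"

lemma linear_fourier_blocks: "linear (fourier_blocks \<phi>)"
  by (rule linearI)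
     (simp_all add: vec_eq_iff fourier_blocks_def linear_add[OF linear_phase_mult]
        linear_add[OF linear_dft2] linear_scale[OF linear_phase_mult] linear_scale[OF linear_dft2])

lemma sum_UNIV_triple:
  "(\<Sum>s\<in>UNIV. f s) = (\<Sum>d\<in>UNIV. \<Sum>p\<in>UNIV. \<Sum>q\<in>UNIV. f (d, p, q))"
  for f :: "'a::finite \<times> 'b::finite \<times> 'c::finite \<Rightarrow> 'd::comm_monoid_add"
  by (simp add: sum.cartesian_product)

lemma norm_fourier_blocks: "norm (fourier_blocks \<phi> w) = norm w"
  for \<phi> :: "('n::{finite,linorder} rarray)^'m::finite"
proof -
  let ?F = "\<lambda>d c. dft2 (phase_mult (\<phi> $ d) (w $ d $ c))"
  have "(norm (fourier_blocks \<phi> w))\<^sup>2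
      = (\<Sum>d\<in>UNIV. \<Sum>p\<in>UNIV. \<Sum>q\<in>UNIV. \<Sum>c\<in>UNIV. (cmod (?F d c $ p $ q))\<^sup>2)"
    by (simp add: norm_sq_vec fourier_blocks_def sum_UNIV_triple)
  also have "\<dots> = (\<Sum>d\<in>UNIV. \<Sum>p\<in>UNIV. \<Sum>c\<in>UNIV. \<Sum>q\<in>UNIV. (cmod (?F d c $ p $ q))\<^sup>2)"
    by (intro sum.cong refl, rule sum.swap)
  also have "\<dots> = (\<Sum>d\<in>UNIV. \<Sum>c\<in>UNIV. \<Sum>p\<in>UNIV. \<Sum>q\<in>UNIV. (cmod (?F d c $ p $ q))\<^sup>2)"
    by (intro sum.cong refl, rule sum.swap)
  also have "\<dots> = (\<Sum>d\<in>UNIV. \<Sum>c\<in>UNIV. (norm (?F d c))\<^sup>2)"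
    by (simp only: norm_sq_array)
  also have "\<dots> = (norm w)\<^sup>2"
    by (simp add: norm_dft2 norm_phase_mult norm_sq_vec[of w] norm_sq_vec[of "w $ _"])
  finally show ?thesis by simp
qed

lemma surj_fourier_blocks: "surj (fourier_blocks \<phi>)"
  for \<phi> :: "('n::{finite,linorder} rarray)^'m::finite"
proof (rule surjI)
  fix v :: "(complex^chan)^('m \<times> 'n \<times> 'n)"
  have "dft2 (phase_mult \<psi> (inv (\<lambda>w. dft2 (phase_mult \<psi> w)) u)) = u" 
    for \<psi> :: "'n rarray" and u :: "'n carray"
    using surj_f_inv_f[OF surj_dft2_phase_mult] by fast
  then show "fourier_blocks \<phi>
      (\<chi> d c. inv (\<lambda>w. dft2 (phase_mult (\<phi> $ d) w)) (\<chi> p q. v $ (d, p, q) $ c)) = v"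
    by (simp add: fourier_blocks_def vec_eq_iff)
qed

lemma norm_fourier_blocks_entry_sq:
  "(norm (fourier_blocks \<phi> w $ (d, p, q)))\<^sup>2 = intensity (\<phi> $ d) (w $ d) $ p $ q"
  by (simp add: norm_sq_vec fourier_blocks_def intensity_def)

text \<open>The given point \<open>b\<close> supplies the radii, which replaces the square roots of the data \<open>r\<close>.\<close>

lemma B_set_eq_sphere_product:
  assumes "b \<in> B_set \<phi> r"
  shows "B_set \<phi> r = {w. \<forall>s. norm (fourier_blocks \<phi> w $ s) = norm (fourier_blocks \<phi> b $ s)}"
proof -
  have "intensity (\<phi> $ d) (b $ d) = r $ d" for d
    using assms by (simp add: B_set_def Omega_def)
  then have "w \<in> B_set \<phi> r \<longleftrightarrow>
      (\<forall>d p q. intensity (\<phi> $ d) (w $ d) $ p $ q = intensity (\<phi> $ d) (b $ d) $ p $ q)" for w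
    by (simp add: B_set_def Omega_def vec_eq_iff)
  also have "\<dots> w \<longleftrightarrow> (\<forall>s. norm (fourier_blocks \<phi> w $ s) = norm (fourier_blocks \<phi> b $ s))" for w
    by (simp flip: norm_fourier_blocks_entry_sq)
  finally show ?thesis by auto
qed

section \<open>Alternating projections\<close>

lemma subspace_A_set: "subspace (A_set k :: (('n::finite hspace)^'m::finite) set)"
proof -
  define L :: "'n carray \<Rightarrow> ('n hspace)^'m"
    where "L x = (\<chi> d c i j. of_real (E_mat k c $ i $ j) * x $ i $ j)" for x
  have "linear L"
    by (rule linearI) (simp_all add: L_def vec_eq_iff distrib_left)
  moreover have "A_set k = range L"
    by (auto simp: A_set_def Omega0_def L_def)
  ultimately show ?thesis
    by (simp add: linear_subspace_image)
qed

theorem proposition6p5: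
  fixes k :: "real^3^'n::{finite,linorder}^'n::{finite,linorder}"
    and \<phi> r :: "('n rarray)^'m::finite"
    and bhat :: "('n hspace)^'m"
  assumes unit_k: "\<And>i j. norm (k $ i $ j) = 1"
    and kZ: "\<And>i j. 1 + k $ i $ j $ 3 \<noteq> 0"
    and r_nonneg: "\<And>d i j. 0 \<le> r $ d $ i $ j"
    and bhat_in: "bhat \<in> B_set \<phi> r"
    and nonzero: "\<And>d i j. amplitude (\<phi> $ d) (bhat $ d) $ i $ j \<noteq> 0"
  shows "\<forall>\<epsilon>>0. \<exists>U. open U \<and> bhat \<in> U \<and>
           almost_averaged_on (alt_proj (A_set k) (B_set \<phi> r)) U \<epsilon> (2 / 3)"
proof (intro allI impI)
  fix \<epsilon> :: real assume "0 < \<epsilon>"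
  let ?F = "fourier_blocks \<phi>"
  let ?\<rho> = "\<lambda>s. norm (?F bhat $ s)"
  \<comment> \<open>The two bounds give \<open>2 \<delta> \<le> \<epsilon>/2\<close> and \<open>(1 - \<delta>)\<^sup>2 \<ge> 9/16\<close>, hence \<open>2 \<delta> \<le> \<epsilon> (1 - \<delta>)\<^sup>2\<close>.\<close>
  define \<delta> where "\<delta> = min (1/4) (\<epsilon>/4)"
  define U where "U = {w. \<forall>s. (1 - \<delta>) * ?\<rho> s < norm (?F w $ s)}"
  have "0 < \<delta>" "\<delta> < 1" "\<delta> \<le> 1/4" "\<delta> \<le> \<epsilon>/4"
    using \<open>0 < \<epsilon>\<close> by (auto simp: \<delta>_def)
  have "(3/4)\<^sup>2 \<le> (1 - \<delta>)\<^sup>2"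
    using \<open>\<delta> \<le> 1/4\<close> by (intro power_mono) auto
  then have "\<epsilon> * (1/2) \<le> \<epsilon> * (1 - \<delta>)\<^sup>2"
    using \<open>0 < \<epsilon>\<close> by (intro mult_left_mono) (auto simp: power2_eq_square)
  then have \<delta>: "2 * \<delta> \<le> \<epsilon> * (1 - \<delta>)\<^sup>2"
    using \<open>\<delta> \<le> \<epsilon>/4\<close> by simp
  have radius: "0 < ?\<rho> s" for s
  proof -
    obtain d p q where s: "s = (d, p, q)" by (metis prod.exhaust)
    have "intensity (\<phi> $ d) (bhat $ d) $ p $ q \<noteq> 0"
      using nonzero[of d p q] by (auto simp: amplitude_def)
    then show ?thesis
      using norm_fourier_blocks_entry_sq[of \<phi> bhat d p q] by (auto simp: s)
  qed
  have "almost_averaged_on (proj (B_set \<phi> r)) U \<epsilon> (1/2)"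
    unfolding B_set_eq_sphere_product[OF bhat_in] U_def
    using \<open>\<delta> < 1\<close> \<delta> \<open>0 < \<epsilon>\<close> radius
    by (intro proj_sphere_product_almost_averaged linear_fourier_blocks norm_fourier_blocks
        surj_fourier_blocks) auto
  moreover have "almost_averaged_on (proj (A_set k :: (('n hspace)^'m) set)) UNIV 0 (1/2)"
    by (intro proj_convex_firmly_nonexpansive subspace_imp_convex closed_subspace subspace_A_set)
  ultimately have "almost_averaged_on (alt_proj (A_set k) (B_set \<phi> r)) U \<epsilon> (2/3)"
    unfolding alt_proj_def[abs_def] by (intro almost_averaged_comp)
  moreover have "bhat \<in> U"
    using radius \<open>0 < \<delta>\<close> by (simp add: U_def)
  moreover have "open U"
  proof -
    have "continuous_on UNIV ?F"
      using linear_fourier_blocks linear_continuous_on linear_conv_bounded_linear by blast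
    then have "open {w. (1 - \<delta>) * ?\<rho> s < norm (?F w $ s)}" for s
      by (intro open_Collect_less continuous_intros)
    then show ?thesis
      unfolding U_def by (simp add: Collect_all_eq open_INT)
  qed
  ultimately show "\<exists>U. open U \<and> bhat \<in> U \<and>
      almost_averaged_on (alt_proj (A_set k) (B_set \<phi> r)) U \<epsilon> (2 / 3)"
    by blast
qed

end
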